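(* Let $r>0$, let $k\ge1$ be an integer, and let $f\in\Gamma_0(\mathbb{R}^n)$ with $f\in\mathcal{C}^k$. Then $e_rf\in\mathcal{C}^k$.
   Context: $\Gamma_0(\mathbb{R}^n)$ is the set of proper, convex, lower semicontinuous functions $f:\mathbb{R}^n\to\mathbb{R}\cup\{\infty\}$. $f\in\mathcal{C}^k$ means that $f$ is finite and $k$ times continuously differentiable on $\mathbb{R}^n$. $\|\cdot\|$ is the Euclidean norm, and the Moreau envelope is $e_rf(x)=\inf_{y\in\mathbb{R}^n}\{f(y)+\frac r2\|y-x\|^2\}$. *)

theory Defs
  imports "HOL-Analysis.Analysis"
begin

text \<open>Extended-valued functions have type \<open>'a \<Rightarrow> ereal\<close>; that the value \<open>-\<infinity>\<close> is never taken
  is part of \<open>proper_fun\<close>.\<close>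

definition proper_fun :: "('a \<Rightarrow> ereal) \<Rightarrow> bool" where
  "proper_fun f \<longleftrightarrow> (\<forall>x. f x \<noteq> -\<infinity>) \<and> (\<exists>x. f x \<noteq> \<infinity>)"

text \<open>Only used together with \<open>proper_fun\<close>, so that \<open>\<infinity> + (-\<infinity>)\<close> never arises on the right.\<close>

definition convex_fun :: "('a::real_vector \<Rightarrow> ereal) \<Rightarrow> bool" where
  "convex_fun f \<longleftrightarrow>
     (\<forall>x y. \<forall>t\<in>{0<..<1::real}.
        f ((1 - t) *\<^sub>R x + t *\<^sub>R y) \<le> ereal (1 - t) * f x + ereal t * f y)"

definition lsc_fun :: "('a::topological_space \<Rightarrow> ereal) \<Rightarrow> bool" where
  "lsc_fun f \<longleftrightarrow> (\<forall>x. f x \<le> Liminf (at x) f)"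

definition Gamma0 :: "('a::euclidean_space \<Rightarrow> ereal) set" where
  "Gamma0 = {f. proper_fun f \<and> convex_fun f \<and> lsc_fun f}"

text \<open>\<open>k\<close> times continuously differentiable on the whole space. In finite dimension the derivative
  map \<open>x \<mapsto> Df(x)\<close> is of class \<open>C\<^sup>k\<close> iff \<open>x \<mapsto> Df(x) v\<close> is for every fixed direction \<open>v\<close>;
  recursing on the latter keeps the type of the function fixed.\<close>

primrec Ck :: "nat \<Rightarrow> ('a::euclidean_space \<Rightarrow> 'b::real_normed_vector) \<Rightarrow> bool" where
  "Ck 0 g \<longleftrightarrow> continuous_on UNIV g"
| "Ck (Suc k) g \<longleftrightarrow>
     (\<forall>x. g differentiable (at x)) \<and> (\<forall>v. Ck k (\<lambda>x. frechet_derivative g (at x) v))"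

definition finite_Ck :: "nat \<Rightarrow> ('a::euclidean_space \<Rightarrow> ereal) \<Rightarrow> bool" where
  "finite_Ck k f \<longleftrightarrow> (\<forall>x. \<bar>f x\<bar> \<noteq> \<infinity>) \<and> Ck k (\<lambda>x. real_of_ereal (f x))"

definition moreau_envelope :: "real \<Rightarrow> ('a::euclidean_space \<Rightarrow> ereal) \<Rightarrow> 'a \<Rightarrow> ereal" where
  "moreau_envelope r f x = (INF y. f y + ereal (r / 2 * (norm (y - x))\<^sup>2))"

end

theory Submission
  imports Defs
begin

text \<open>Let \<open>P x\<close> be the proximal point, the minimizer in the definition of the envelope at \<open>x\<close>.
  It solves \<open>T (P x) = x\<close> for \<open>T y = y + \<nabla>f(y) / r\<close>. Since \<open>\<nabla>f\<close> is monotone, \<open>T\<close> is expansive;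
  hence \<open>P\<close> is nonexpansive and \<open>DT\<close>, where it exists, is invertible, so \<open>P\<close> is as smooth as \<open>T\<close>,
  namely \<open>C\<^sup>k\<^sup>-\<^sup>1\<close>. The envelope has gradient \<open>r (x - P x)\<close>, which makes it \<open>C\<^sup>k\<close>.\<close>

section \<open>Closure properties of the class \<open>Ck\<close>\<close>

text \<open>By uniqueness of the derivative, any explicit formula for it may stand in for
  \<open>frechet_derivative\<close>; the closure proofs below rest on this.\<close>

lemma Ck_SucI:
  assumes "\<And>x. (g has_derivative g' x) (at x)" "\<And>v. Ck k (\<lambda>x. g' x v)"
  shows "Ck (Suc k) g"
proof -
  have "frechet_derivative g (at x) = g' x" for x
    using frechet_derivative_at[OF assms(1)] by simp
  then show ?thesis
    using assms by (auto simp: differentiable_def)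
qed

lemma Ck_SucD:
  assumes "Ck (Suc k) g"
  shows "(g has_derivative frechet_derivative g (at x)) (at x)"
    and "Ck k (\<lambda>x. frechet_derivative g (at x) v)"
  using assms by (auto simp: frechet_derivative_works)

lemma Ck_Suc_imp_Ck: "Ck (Suc k) g \<Longrightarrow> Ck k g"
proof (induction k arbitrary: g)
  case 0
  then show ?case
    by (auto simp: continuous_on_eq_continuous_within intro: differentiable_imp_continuous_within)
next
  case (Suc k)
  then show ?case by (metis Ck.simps(2))
qed

lemma Ck_mono: "Ck m g \<Longrightarrow> k \<le> m \<Longrightarrow> Ck k g"
  by (induction m) (auto simp: le_Suc_eq dest: Ck_Suc_imp_Ck simp del: Ck.simps(2))

lemma Ck_const: "Ck k (\<lambda>x. c)"
proof (induction k arbitrary: c)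
  case (Suc k)
  then show ?case by (intro Ck_SucI[OF has_derivative_const])
qed simp

lemma Ck_ident: "Ck k (\<lambda>x. x)"
proof (cases k)
  case (Suc m)
  then show ?thesis
    using Ck_SucI[of "\<lambda>x. x" "\<lambda>_ v. v" m] Ck_const has_derivative_ident by blast
qed simp

lemma Ck_add: "Ck k f \<Longrightarrow> Ck k g \<Longrightarrow> Ck k (\<lambda>x. f x + g x)"
proof (induction k arbitrary: f g)
  case (Suc k)
  show ?case
    by (intro Ck_SucI[OF has_derivative_add[OF Suc.prems[THEN Ck_SucD(1)]]]
        Suc.IH Suc.prems[THEN Ck_SucD(2)])
qed (simp add: continuous_on_add)

text \<open>The product rule gives a sum of two products of the same bilinear kind, so the induction
  closes once both factors are left arbitrary.\<close>

lemma (in bounded_bilinear) Ck: "Ck k f \<Longrightarrow> Ck k g \<Longrightarrow> Ck k (\<lambda>x. prod (f x) (g x))"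
proof (induction k arbitrary: f g)
  case (Suc k)
  show ?case
    by (intro Ck_SucI[OF FDERIV[OF Suc.prems[THEN Ck_SucD(1)]]] Ck_add Suc.IH
        Suc.prems[THEN Ck_SucD(2)] Suc.prems[THEN Ck_Suc_imp_Ck])
qed (simp add: continuous_on)

lemmas Ck_mult = bounded_bilinear.Ck[OF bounded_bilinear_mult]
  and Ck_scaleR = bounded_bilinear.Ck[OF bounded_bilinear_scaleR]
  and Ck_inner = bounded_bilinear.Ck[OF bounded_bilinear_inner]

lemma Ck_diff:
  assumes "Ck k f" "Ck k g"
  shows "Ck k (\<lambda>x. f x - g x)"
  using Ck_add[OF assms(1) Ck_scaleR[OF Ck_const[of k "-1"] assms(2)]] by simp

lemma Ck_sum: "(\<And>i. i \<in> I \<Longrightarrow> Ck k (f i)) \<Longrightarrow> Ck k (\<lambda>x. \<Sum>i\<in>I. f i x)"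
  by (induction I rule: infinite_finite_induct) (auto intro: Ck_const Ck_add)

lemma Ck_prod:
  fixes f :: "_ \<Rightarrow> _ \<Rightarrow> real"
  shows "(\<And>i. i \<in> I \<Longrightarrow> Ck k (f i)) \<Longrightarrow> Ck k (\<lambda>x. \<Prod>i\<in>I. f i x)"
  by (induction I rule: infinite_finite_induct) (auto intro: Ck_const Ck_mult)

text \<open>The derivative of \<open>inverse (f x)\<close> involves \<open>inverse (f x)\<close>
  itself, but only at the order already supplied by the induction hypothesis.\<close>

lemma Ck_inverse:
  fixes f :: "_ \<Rightarrow> real"
  assumes "\<And>x. f x \<noteq> 0"
  shows "Ck k f \<Longrightarrow> Ck k (\<lambda>x. inverse (f x))"
proof (induction k)
  case 0
  then show ?case using assms by (simp add: continuous_on_inverse)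
next
  case (Suc k)
  have "Ck k (\<lambda>x. inverse (f x))"
    by (rule Suc.IH[OF Ck_Suc_imp_Ck[OF Suc.prems]])
  then have "Ck k (\<lambda>x. 0 - inverse (f x) * frechet_derivative f (at x) v * inverse (f x))" for v
    using Suc.prems by (intro Ck_diff Ck_const Ck_mult Ck_SucD(2))
  then show ?case
    by (intro Ck_SucI[OF Deriv.has_derivative_inverse[OF assms Ck_SucD(1)[OF Suc.prems]]]) simp
qed

lemma Ck_divide:
  fixes f g :: "_ \<Rightarrow> real"
  shows "Ck k f \<Longrightarrow> Ck k g \<Longrightarrow> (\<And>x. g x \<noteq> 0) \<Longrightarrow> Ck k (\<lambda>x. f x / g x)"
  by (simp add: divide_inverse Ck_mult Ck_inverse)

lemma linear_Basis_expansion: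
  fixes L :: "'a::euclidean_space \<Rightarrow> 'b::real_normed_vector"
  assumes "linear L"
  shows "L u = (\<Sum>i\<in>Basis. (u \<bullet> i) *\<^sub>R L i)"
proof -
  have "L (\<Sum>i\<in>Basis. (u \<bullet> i) *\<^sub>R i) = (\<Sum>i\<in>Basis. (u \<bullet> i) *\<^sub>R L i)"
    by (simp only: linear_sum[OF assms] linear_cmul[OF assms])
  then show ?thesis by (simp only: euclidean_representation)
qed

text \<open>The chain rule applies the derivative of \<open>g\<close> in a direction that varies
  with \<open>x\<close>, whereas \<open>Ck\<close> controls fixed directions only. Expanding the
  direction in the basis reduces one to the other.\<close>

lemma Ck_compose: "Ck k g \<Longrightarrow> Ck k p \<Longrightarrow> Ck k (\<lambda>x. g (p x))"
proof (induction k arbitrary: g)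
  case 0
  then show ?case
    using continuous_on_compose2[of UNIV g UNIV p] by simp
next
  case (Suc k)
  have *: "frechet_derivative g (at (p x)) u = (\<Sum>i\<in>Basis. (u \<bullet> i) *\<^sub>R frechet_derivative g (at (p x)) i)" for x u
    using Suc.prems(1) by (intro linear_Basis_expansion linear_frechet_derivative) simp
  have "Ck k (\<lambda>x. \<Sum>i\<in>Basis. (frechet_derivative p (at x) v \<bullet> i) *\<^sub>R frechet_derivative g (at (p x)) i)" for v
  proof (intro Ck_sum Ck_scaleR Ck_inner Ck_const)
    show "Ck k (\<lambda>x. frechet_derivative g (at (p x)) i)" for i
      by (rule Suc.IH[OF Ck_SucD(2)[OF Suc.prems(1)] Ck_Suc_imp_Ck[OF Suc.prems(2)]])
    show "Ck k (\<lambda>x. frechet_derivative p (at x) v)"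
      using Suc.prems by simp
  qed
  then show ?case
    unfolding *[symmetric]
    by (rule Ck_SucI[OF has_derivative_compose[OF Ck_SucD(1)[OF Suc.prems(2)] Ck_SucD(1)[OF Suc.prems(1)]]])
qed

lemma Ck_euclidean:
  fixes f :: "'a::euclidean_space \<Rightarrow> 'b::euclidean_space"
  assumes "\<And>i. i \<in> Basis \<Longrightarrow> Ck k (\<lambda>x. f x \<bullet> i)"
  shows "Ck k f"
proof -
  have "Ck k (\<lambda>x. \<Sum>i\<in>Basis. (f x \<bullet> i) *\<^sub>R i)"
    by (intro Ck_sum Ck_scaleR Ck_const assms)
  then show ?thesis by (simp add: euclidean_representation)
qed

lemma Ck_det:
  fixes A :: "_ \<Rightarrow> real^'n^'n"
  assumes "\<And>i j. Ck k (\<lambda>x. A x $ i $ j)"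
  shows "Ck k (\<lambda>x. det (A x))"
  unfolding det_def by (intro Ck_sum Ck_mult Ck_prod Ck_const assms)

section \<open>Smoothness of the right inverse of an expansive map\<close>

text \<open>Along a kernel direction \<open>T\<close> moves by \<open>o(t)\<close>, while
  expansiveness forces a displacement of at least \<open>t * norm v\<close>.\<close>

lemma expansive_derivative_kernel:
  fixes T :: "'a::real_normed_vector \<Rightarrow> 'b::real_normed_vector"
  assumes exp: "\<And>y z. norm (y - z) \<le> norm (T y - T z)"
    and T': "(T has_derivative T') (at y)"
    and v: "T' v = 0"
  shows "v = 0"
proof (rule ccontr)
  assume "v \<noteq> 0"
  interpret T': bounded_linear T' using T' by (rule has_derivative_bounded_linear)
  \<comment> \<open>Any error factor below 1 contradicts expansiveness; 1/2 is such a
    choice.\<close>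
  obtain d where "d > 0"
    and d: "\<And>z. norm (z - y) < d \<Longrightarrow> norm (T z - T y - T' (z - y)) \<le> 1/2 * norm (z - y)"
    using T' unfolding has_derivative_at_alt by (metis half_gt_zero_iff zero_less_one)
  define t where "t = d / (2 * norm v)"
  have t: "t * norm v = d / 2" "t > 0"
    using \<open>v \<noteq> 0\<close> \<open>d > 0\<close> by (auto simp: t_def)
  have "norm (t *\<^sub>R v) = d / 2"
    using t by simp
  then show False
    using d[of "y + t *\<^sub>R v"] exp[of "y + t *\<^sub>R v" y] \<open>d > 0\<close> by (simp add: T'.scaleR v)
qed

text \<open>By induction on the order: \<open>DP(x) = DT(P x)\<^sup>-\<^sup>1\<close> gains one order over \<open>P\<close>, its entries being
  rational functions of those of \<open>DT(P x)\<close> by Cramer's rule.\<close>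
lemma Ck_expansive_right_inverse:
  fixes T P :: "real^'n \<Rightarrow> real^'n"
  assumes exp: "\<And>y z. norm (y - z) \<le> norm (T y - T z)"
    and TP: "\<And>x. T (P x) = x"
    and T: "Ck m T"
  shows "Ck m P"
proof -
  have contP: "continuous_on UNIV P"
  proof (rule lipschitz_on_continuous_on, rule lipschitz_onI)
    show "dist (P x) (P y) \<le> 1 * dist x y" for x y
      using exp[of "P x" "P y"] by (simp add: TP dist_norm)
  qed simp
  have "Ck j P" if "j \<le> m" for j
    using that
  proof (induction j)
    case 0
    show ?case using contP by simp
  next
    case (Suc j)
    then have P: "Ck j P" by simp
    have T: "Ck (Suc j) T"
      using T Suc.prems by (rule Ck_mono)
    define A where "A y = matrix (frechet_derivative T (at y))" for y
    have lin: "linear (frechet_derivative T (at y))" for y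
      using T by (auto intro: linear_frechet_derivative)
    have Av: "A y *v v = frechet_derivative T (at y) v" for y v
      unfolding A_def by (simp add: lin matrix_works)
    \<comment> \<open>A square matrix with trivial kernel is invertible.\<close>
    have invertible: "invertible (A y)" for y
      unfolding invertible_left_inverse matrix_left_invertible_ker Av
      using expansive_derivative_kernel[OF exp Ck_SucD(1)[OF T]] by blast
    then have det: "det (A y) \<noteq> 0" for y
      by (simp add: invertible_det_nz)
    obtain B where inv: "A y ** B y = mat 1" "B y ** A y = mat 1" for y
      using invertible unfolding invertible_def by metis
    define Q where "Q x v = B (P x) *v v" for x v
    have "(P has_derivative Q x) (at x)" for x
    proof (rule has_derivative_inverse_basic[OF Ck_SucD(1)[OF T]])
      show "bounded_linear (Q x)"
        unfolding Q_def by (simp add: matrix_vector_mul_bounded_linear)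
      show "Q x \<circ> frechet_derivative T (at (P x)) = id"
        by (simp add: Q_def fun_eq_iff Av[symmetric] matrix_vector_mul_assoc inv)
      show "continuous (at x) P" using contP by (simp add: continuous_on_eq_continuous_at)
      show "T (P z) = z" for z by (rule TP)
      show "open (UNIV :: (real^'n) set)" "x \<in> UNIV" by simp_all
    qed
    moreover have "Ck j (\<lambda>x. Q x v)" for v
    proof -
      have "A (P x) *v Q x v = v" for x
        by (simp add: Q_def matrix_vector_mul_assoc inv)
      \<comment> \<open>\<open>B\<close> was chosen pointwise, so its regularity in \<open>x\<close>
        is not visible; Cramer's rule supplies a formula from which it can be read off.\<close>
      then have Q: "Q x v = (\<chi> k. det (\<chi> i l. if l = k then v $ i else A (P x) $ i $ l) / det (A (P x)))" for x
        by (rule iffD1[OF cramer[OF det]])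
      have A: "Ck j (\<lambda>x. A (P x) $ i $ l)" for i l
      proof -
        \<comment> \<open>Column \<open>l\<close> of \<open>A y\<close> is the derivative of
          \<open>T\<close> in the fixed direction \<open>axis l 1\<close>.\<close>
        have "Ck j (\<lambda>y. frechet_derivative T (at y) (axis l 1) \<bullet> axis i 1)"
          by (intro Ck_inner Ck_const Ck_SucD[OF T])
        then have "Ck j (\<lambda>y. A y $ i $ l)"
          by (simp add: A_def matrix_def inner_axis)
        then show ?thesis using P by (rule Ck_compose)
      qed
      have entry: "Ck j (\<lambda>x. if l = k then v $ i else A (P x) $ i $ l)" for i l k
        using A Ck_const by (cases "l = k") simp_all
      show ?thesis
      proof (rule Ck_euclidean)
        fix b :: "real^'n"
        assume "b \<in> Basis"
        then obtain k where b: "b = axis k 1"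
          by (auto simp: Basis_vec_def)
        show "Ck j (\<lambda>x. Q x v \<bullet> b)"
          unfolding b inner_axis inner_real_def mult_1_right Q vec_lambda_beta
          by (intro Ck_divide Ck_det A det) (simp only: vec_lambda_beta entry)
      qed
    qed
    ultimately show ?case by (rule Ck_SucI)
  qed
  then show ?thesis by simp
qed

section \<open>Convexity and the proximal point\<close>

text \<open>Restricting \<open>g\<close> to the line through \<open>x\<close> and \<open>y\<close>
  reduces this to the tangent inequality in one variable.\<close>

lemma convex_above_tangent:
  fixes g :: "'a::real_normed_vector \<Rightarrow> real"
  assumes "convex_on UNIV g" and g': "(g has_derivative g') (at x)"
  shows "g x + g' (y - x) \<le> g y"
proof -
  interpret g': bounded_linear g' using g' by (rule has_derivative_bounded_linear)
  let ?l = "\<lambda>t. x + t *\<^sub>R (y - x)"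
  have "convex_on UNIV (g \<circ> ?l)"
  proof (rule convex_onI)
    fix t a b :: real
    assume "0 < t" "t < 1"
    moreover have "?l ((1 - t) *\<^sub>R a + t *\<^sub>R b) = (1 - t) *\<^sub>R ?l a + t *\<^sub>R ?l b"
      by (simp add: algebra_simps)
    ultimately show "(g \<circ> ?l) ((1 - t) *\<^sub>R a + t *\<^sub>R b) \<le> (1 - t) * (g \<circ> ?l) a + t * (g \<circ> ?l) b"
      using convex_onD[OF assms(1), of t "?l a" "?l b"] by simp
  qed simp
  moreover have "(g \<circ> ?l has_field_derivative g' (y - x)) (at 0)"
  proof -
    have "((\<lambda>t. g (?l t)) has_derivative (\<lambda>t. g' (t *\<^sub>R (y - x)))) (at 0)"
      by (rule has_derivative_compose[where f = ?l]) (auto intro!: derivative_eq_intros g')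
    then show ?thesis
      by (simp add: has_field_derivative_def g'.scaleR o_def mult.commute[of _ "g' (y - x)"] mult_commute_abs)
  qed
  ultimately show ?thesis
    using convex_on_imp_above_tangent[of UNIV "g \<circ> ?l" 0 1 "g' (y - x)"] by simp
qed

text \<open>Add the tangent inequalities at \<open>y\<close> and at \<open>z\<close>.\<close>

lemma gradient_mono:
  fixes g :: "'a::real_inner \<Rightarrow> real"
  assumes "convex_on UNIV g" and "\<And>y. (g has_derivative (\<lambda>h. G y \<bullet> h)) (at y)"
  shows "(G y - G z) \<bullet> (y - z) \<ge> 0"
  using convex_above_tangent[OF assms, of y z] convex_above_tangent[OF assms, of z y]
  by (simp add: inner_diff_left inner_diff_right)

text \<open>Compactness gives a minimizer on a ball around \<open>x\<close>. Outside the ball, the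
  tangent at \<open>x\<close> and the Cauchy-Schwarz inequality keep the objective at or above
  \<open>g x\<close>, its value at the centre.\<close>

lemma prox_exists:
  fixes g :: "'a::euclidean_space \<Rightarrow> real"
  assumes "r > 0" and cvx: "convex_on UNIV g"
    and G: "\<And>y. (g has_derivative (\<lambda>h. G y \<bullet> h)) (at y)"
  shows "\<exists>p. \<forall>z. g p + r / 2 * (norm (p - x))\<^sup>2 \<le> g z + r / 2 * (norm (z - x))\<^sup>2"
proof -
  let ?\<phi> = "\<lambda>z. g z + r / 2 * (norm (z - x))\<^sup>2"
  \<comment> \<open>From this distance on, the quadratic term dominates the linear decrease, whose
    slope is at most \<open>norm (G x)\<close>.\<close>
  define R where "R = 2 * norm (G x) / r"
  have "R \<ge> 0"
    using \<open>r > 0\<close> by (simp add: R_def)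
  have cont: "continuous_on S g" for S
    by (rule has_derivative_continuous_on[OF has_derivative_at_withinI[OF G]])
  have "\<exists>p\<in>cball x R. \<forall>z\<in>cball x R. ?\<phi> p \<le> ?\<phi> z"
    using \<open>R \<ge> 0\<close> by (intro continuous_attains_inf continuous_intros cont) auto
  then obtain p where p: "\<And>z. z \<in> cball x R \<Longrightarrow> ?\<phi> p \<le> ?\<phi> z" by blast
  have "?\<phi> p \<le> ?\<phi> z" for z
  proof (cases "z \<in> cball x R")
    case False
    then have "norm (G x) \<le> r / 2 * norm (z - x)"
      using \<open>r > 0\<close> by (simp add: R_def dist_norm norm_minus_commute field_simps)
    then have "norm (G x) * norm (z - x) \<le> r / 2 * (norm (z - x))\<^sup>2"
      using mult_right_mono[of "norm (G x)" "r / 2 * norm (z - x)" "norm (z - x)"]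
      by (simp add: power2_eq_square mult.assoc)
    moreover have "- (norm (G x) * norm (z - x)) \<le> G x \<bullet> (z - x)"
      using Cauchy_Schwarz_ineq2[of "G x" "z - x"] by linarith
    moreover have "g x + G x \<bullet> (z - x) \<le> g z"
      using convex_above_tangent[OF cvx G] .
    moreover have "?\<phi> p \<le> g x"
      using p[of x] \<open>R \<ge> 0\<close> by simp
    ultimately show ?thesis by linarith
  qed (rule p)
  then show ?thesis by blast
qed

text \<open>Fermat's rule: the derivative of the objective vanishes at its minimizer. This yields
  the equation \<open>T (P x) = x\<close>.\<close>

lemma prox_stationary:
  fixes g :: "'a::real_inner \<Rightarrow> real"
  assumes G: "(g has_derivative (\<lambda>h. d \<bullet> h)) (at p)"
    and min: "\<And>z. g p + r / 2 * (norm (p - x))\<^sup>2 \<le> g z + r / 2 * (norm (z - x))\<^sup>2"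
  shows "d = r *\<^sub>R (x - p)"
proof -
  have "((\<lambda>z. g z + r / 2 * ((z - x) \<bullet> (z - x))) has_derivative
      (\<lambda>h. d \<bullet> h + r * ((p - x) \<bullet> h))) (at p)"
    by (rule derivative_eq_intros G refl | simp add: inner_commute algebra_simps)+
  then have "(\<lambda>h. d \<bullet> h + r * ((p - x) \<bullet> h)) = (\<lambda>_. 0)"
    by (rule differential_zero_maxmin[of p UNIV, rotated 2])
       (use min in \<open>auto simp: power2_norm_eq_inner\<close>)
  then have "(d - r *\<^sub>R (x - p)) \<bullet> h = 0" for h
    by (drule_tac x = h in fun_cong) (simp add: algebra_simps inner_simps)
  from this[of "d - r *\<^sub>R (x - p)"] show ?thesis by simp
qed

section \<open>Gradient of the envelope\<close>

text \<open>The minimizer at one point is a competitor at the other, which bounds the increment of the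
  envelope above and below; nonexpansiveness of \<open>P\<close> makes both bounds agree up to a quadratic error.\<close>
lemma envelope_has_derivative:
  fixes g :: "'a::real_inner \<Rightarrow> real"
  assumes "r > 0"
    and min: "\<And>x z. g (P x) + r / 2 * (norm (P x - x))\<^sup>2 \<le> g z + r / 2 * (norm (z - x))\<^sup>2"
    and nonexp: "\<And>x y. norm (P x - P y) \<le> norm (x - y)"
  shows "((\<lambda>x. g (P x) + r / 2 * (norm (P x - x))\<^sup>2) has_derivative (\<lambda>h. r * ((x - P x) \<bullet> h))) (at x)"
proof -
  let ?e = "\<lambda>x. g (P x) + r / 2 * (norm (P x - x))\<^sup>2"
  have ub: "?e y - ?e x \<le> r * ((x - P x) \<bullet> (y - x)) + r / 2 * (norm (y - x))\<^sup>2" for x y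
  proof -
    have "(norm (P x - y))\<^sup>2 = (norm (P x - x))\<^sup>2 + 2 * ((x - P x) \<bullet> (y - x)) + (norm (y - x))\<^sup>2"
      by (simp add: power2_norm_eq_inner algebra_simps inner_simps inner_commute)
    then have "?e y \<le> g (P x) + r / 2 * ((norm (P x - x))\<^sup>2 + 2 * ((x - P x) \<bullet> (y - x)) + (norm (y - x))\<^sup>2)"
      using min[of y "P x"] by simp
    then show ?thesis by (simp add: distrib_left)
  qed
  have bound: "\<bar>?e y - ?e x - r * ((x - P x) \<bullet> (y - x))\<bar> \<le> r / 2 * (norm (y - x))\<^sup>2" for y
  proof -
    have "(P y - P x) \<bullet> (y - x) \<le> (norm (y - x))\<^sup>2"
      using norm_cauchy_schwarz[of "P y - P x" "y - x"]
        mult_right_mono[OF nonexp[of y x] norm_ge_zero[of "y - x"]]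
      unfolding power2_eq_square by linarith
    then have "r * ((P y - P x) \<bullet> (y - x)) \<le> r * (norm (y - x))\<^sup>2"
      using \<open>r > 0\<close> by simp
    \<comment> \<open>Exchanging the points in \<open>ub\<close> puts the slope at \<open>y\<close>;
      this identity moves it back to \<open>x\<close>. Nonexpansiveness bounds the extra term by
      \<open>r * (norm (y - x))\<^sup>2\<close>, so the lower bound has the same error constant
      \<open>r / 2\<close>.\<close>
    moreover have "r * ((y - P y) \<bullet> (x - y)) + r * (norm (y - x))\<^sup>2
        = r * ((P y - P x) \<bullet> (y - x)) - r * ((x - P x) \<bullet> (y - x))"
      by (simp add: power2_norm_eq_inner algebra_simps inner_simps inner_commute)
    ultimately show ?thesis
      using ub[of y x] ub[of x y] unfolding norm_minus_commute[of x y] by (intro abs_leI) linarith+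
  qed
  show ?thesis
  proof (rule has_derivativeI_sandwich[of 1])
    show "bounded_linear (\<lambda>h. r * ((x - P x) \<bullet> h))"
      by (intro bounded_linear_intros)
    show "norm (?e y - ?e x - r * ((x - P x) \<bullet> (y - x))) / norm (y - x) \<le> r / 2 * norm (y - x)"
      if "y \<noteq> x" for y
      using bound[of y] that by (simp add: divide_le_eq power2_eq_square)
    show "((\<lambda>y. r / 2 * norm (y - x)) \<longlongrightarrow> 0) (at x)"
      by (auto intro!: tendsto_eq_intros)
  qed simp
qed

text \<open>The gradient is assembled from the partial derivatives, each of which is of class
  \<open>Ck m\<close>.\<close>

lemma Ck_Suc_gradient:
  fixes g :: "'a::euclidean_space \<Rightarrow> real"
  assumes "Ck (Suc m) g"
  shows "\<exists>G. (\<forall>y. (g has_derivative (\<lambda>h. G y \<bullet> h)) (at y)) \<and> Ck m G"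
proof (intro exI conjI allI)
  let ?G = "\<lambda>y. \<Sum>i\<in>Basis. frechet_derivative g (at y) i *\<^sub>R i"
  show "Ck m ?G"
    by (intro Ck_sum Ck_scaleR Ck_const Ck_SucD[OF assms])
  show "(g has_derivative (\<lambda>h. ?G y \<bullet> h)) (at y)" for y
  proof -
    have "linear (frechet_derivative g (at y))"
      using assms by (auto intro: linear_frechet_derivative)
    then have "frechet_derivative g (at y) h = (\<Sum>i\<in>Basis. (h \<bullet> i) *\<^sub>R frechet_derivative g (at y) i)" for h
      by (rule linear_Basis_expansion)
    also have "(\<Sum>i\<in>Basis. (h \<bullet> i) *\<^sub>R frechet_derivative g (at y) i) = ?G y \<bullet> h" for h
      unfolding inner_sum_left inner_scaleR_left real_scaleR_def inner_commute[of h]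
      by (rule sum.cong[OF refl mult.commute])
    finally have "frechet_derivative g (at y) = (\<lambda>h. ?G y \<bullet> h)"
      by (rule ext)
    then show ?thesis
      using Ck_SucD(1)[OF assms, of y] by simp
  qed
qed

theorem theorem3p12:
  fixes r :: real and k :: nat and f :: "real ^ 'n \<Rightarrow> ereal"
  assumes "r > 0"
    and "k \<ge> 1"
    and "f \<in> Gamma0"
    and "finite_Ck k f"
  shows "finite_Ck k (moreau_envelope r f)"
proof -
  define g where "g x = real_of_ereal (f x)" for x
  have f: "f x = ereal (g x)" for x
    using assms(4) by (simp add: finite_Ck_def g_def ereal_real')
  obtain m where k: "k = Suc m"
    using assms(2) by (cases k) auto
  have "Ck (Suc m) g"
    using assms(4) k by (simp only: finite_Ck_def g_def[abs_def])
  then obtain G where G: "\<And>y. (g has_derivative (\<lambda>h. G y \<bullet> h)) (at y)" and CkG: "Ck m G"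
    using Ck_Suc_gradient by blast
  have cvx: "convex_on UNIV g"
  proof (rule convex_onI)
    fix t :: real and x y
    assume "0 < t" "t < 1"
    moreover have "convex_fun f" using assms(3) by (simp add: Gamma0_def)
    ultimately have "f ((1 - t) *\<^sub>R x + t *\<^sub>R y) \<le> ereal (1 - t) * f x + ereal t * f y"
      unfolding convex_fun_def by simp
    then show "g ((1 - t) *\<^sub>R x + t *\<^sub>R y) \<le> (1 - t) * g x + t * g y"
      by (simp add: f)
  qed simp
  have "\<forall>x. \<exists>p. \<forall>z. g p + r / 2 * (norm (p - x))\<^sup>2 \<le> g z + r / 2 * (norm (z - x))\<^sup>2"
    using prox_exists[OF assms(1) cvx G] by blast
  from choice[OF this] obtain P
    where min: "g (P x) + r / 2 * (norm (P x - x))\<^sup>2 \<le> g z + r / 2 * (norm (z - x))\<^sup>2" for x z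
    by blast
  define T where "T y = y + (1 / r) *\<^sub>R G y" for y
  have TP: "T (P x) = x" for x
    using prox_stationary[OF G min, of x] assms(1) by (simp add: T_def)
  have exp: "norm (y - z) \<le> norm (T y - T z)" for y z
  proof -
    \<comment> \<open>Monotonicity of the gradient makes \<open>T\<close> strongly monotone with
      constant 1; Cauchy-Schwarz turns this into expansiveness.\<close>
    have "(T y - T z) \<bullet> (y - z) = (norm (y - z))\<^sup>2 + (1 / r) * ((G y - G z) \<bullet> (y - z))"
      by (simp add: T_def power2_norm_eq_inner algebra_simps inner_simps)
    also have "\<dots> \<ge> (norm (y - z))\<^sup>2"
      using gradient_mono[OF cvx G, of y z] assms(1) by simp
    finally have "norm (y - z) * norm (y - z) \<le> norm (T y - T z) * norm (y - z)"
      using norm_cauchy_schwarz[of "T y - T z" "y - z"] by (simp add: power2_eq_square)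
    then show ?thesis
      by (cases "y = z") auto
  qed
  have nonexp: "norm (P x - P y) \<le> norm (x - y)" for x y
    using exp[of "P x" "P y"] by (simp add: TP)
  let ?e = "\<lambda>x. g (P x) + r / 2 * (norm (P x - x))\<^sup>2"
  have env: "moreau_envelope r f x = ereal (?e x)" for x
    unfolding moreau_envelope_def
  proof (rule antisym)
    show "(INF y. f y + ereal (r / 2 * (norm (y - x))\<^sup>2)) \<le> ereal (?e x)"
      by (rule INF_lower2[of "P x"]) (simp_all add: f)
    show "ereal (?e x) \<le> (INF y. f y + ereal (r / 2 * (norm (y - x))\<^sup>2))"
      by (rule INF_greatest) (use min[of x] in \<open>simp add: f\<close>)
  qed
  have "Ck m T"
    unfolding T_def[abs_def] by (intro Ck_add Ck_scaleR Ck_ident Ck_const CkG)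
  with exp TP have "Ck m P" by (rule Ck_expansive_right_inverse)
  \<comment> \<open>The order lost in passing from \<open>g\<close> to \<open>G\<close> is regained
    here: \<open>P\<close> is known to be \<open>Ck m\<close> and enters the derivative of the
    envelope.\<close>
  then have "Ck m (\<lambda>x. r * ((x - P x) \<bullet> v))" for v
    by (intro Ck_mult Ck_inner Ck_diff Ck_const Ck_ident)
  with envelope_has_derivative[OF assms(1) min nonexp] have "Ck (Suc m) ?e"
    by (rule Ck_SucI)
  then show ?thesis
    by (simp only: finite_Ck_def env k) simp
qed

end
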